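(* Let $n\ge m$ and $\nu=w\mu$ with $w$ a probability density w.r.t. $\mu$. If $(x_1,\dots,x_n)\sim\gamma_m\otimes\nu^{\otimes(n-m)}$ and $\sigma$ is an independent uniformly random permutation of $\{1,\dots,n\}$, then $(x_{\sigma(1)},\dots,x_{\sigma(n)})\sim\gamma_n^\nu$. The marginals of $\gamma_n^\nu$ are all equal to $\tilde\nu=\tilde w\mu$ with $\tilde w=\frac mn w_m+\frac{n-m}{n}w$. If $w\ge\alpha w_m$ for some $\alpha>0$, then $$\Big(1-\frac mn\Big)w\le\tilde w\le\Big(1+(\alpha^{-1}-1)\frac mn\Big)w.$$
   Context: $\mathcal X$ is a Polish space with Borel probability measure $\mu$. $V_m\subset L^2_\mu$ is an $m$-dimensional subspace with $L^2_\mu$-orthonormal basis $\varphi_1,\dots,\varphi_m$, $\boldsymbol\varphi=(\varphi_1,\dots,\varphi_m)^T$, $w_m(x)=\frac1m\|\boldsymbol\varphi(x)\|_2^2$. For $\mathbf x=(x_1,\dots,x_k)$, $\Phi(\mathbf x)\in\mathbb R^{k\times m}$ has rows $\boldsymbol\varphi(x_i)^T$ and $\Phi^w(\mathbf x)$ has rows $w(x_i)^{-1/2}\boldsymbol\varphi(x_i)^T$. $\gamma_m$ is the probability measure on $\mathcal X^m$ with $d\gamma_m(\mathbf x)=\frac1{m!}\det(\Phi(\mathbf x)^T\Phi(\mathbf x))\,d\mu^{\otimes m}(\mathbf x)$ (projection determinantal point process). For a probability measure $\nu=w\mu$ and $n\ge m$, $\gamma_n^\nu$ is the probability measure on $\mathcal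 X^n$ with $d\gamma_n^\nu(\mathbf x)=\frac{(n-m)!}{n!}\det(\Phi^w(\mathbf x)^T\Phi^w(\mathbf x))\,d\nu^{\otimes n}(\mathbf x)$ (generalized volume sampling).
   Formalization: It is additionally assumed that φ(x)=0 for μ-almost every x with w(x)=0; this is exactly the condition for γ_n^ν to be a probability measure, and it is implied by w ≥ αw_m. *)

theory Defs
  imports "HOL-Probability.Probability"
begin

definition ldet :: "nat \<Rightarrow> (nat \<Rightarrow> nat \<Rightarrow> real) \<Rightarrow> real" where
  "ldet k A = (\<Sum>p\<in>{p. p permutes {..<k}}. of_int (sign p) * (\<Prod>i<k. A i (p i)))"

definition gram :: "nat \<Rightarrow> (nat \<Rightarrow> nat \<Rightarrow> real) \<Rightarrow> nat \<Rightarrow> nat \<Rightarrow> real" where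
  "gram k B = (\<lambda>i j. \<Sum>l<k. B l i * B l j)"

definition Phi :: "(nat \<Rightarrow> 'a \<Rightarrow> real) \<Rightarrow> (nat \<Rightarrow> 'a) \<Rightarrow> nat \<Rightarrow> nat \<Rightarrow> real" where
  "Phi \<phi> x = (\<lambda>i j. \<phi> j (x i))"

definition PhiW :: "(nat \<Rightarrow> 'a \<Rightarrow> real) \<Rightarrow> ('a \<Rightarrow> real) \<Rightarrow> (nat \<Rightarrow> 'a) \<Rightarrow> nat \<Rightarrow> nat \<Rightarrow> real" where
  "PhiW \<phi> w x = (\<lambda>i j. \<phi> j (x i) / sqrt (w (x i)))"

definition wm :: "(nat \<Rightarrow> 'a \<Rightarrow> real) \<Rightarrow> nat \<Rightarrow> 'a \<Rightarrow> real" where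
  "wm \<phi> m x = (1 / real m) * (\<Sum>j<m. (\<phi> j x)\<^sup>2)"

definition dpp :: "'a measure \<Rightarrow> (nat \<Rightarrow> 'a \<Rightarrow> real) \<Rightarrow> nat \<Rightarrow> (nat \<Rightarrow> 'a) measure" where
  "dpp \<mu> \<phi> m = density (PiM {..<m} (\<lambda>_. \<mu>))
      (\<lambda>x. ennreal (ldet m (gram m (Phi \<phi> x)) / fact m))"

definition vol_sampling :: "'a measure \<Rightarrow> (nat \<Rightarrow> 'a \<Rightarrow> real) \<Rightarrow> nat \<Rightarrow> ('a \<Rightarrow> real) \<Rightarrow> nat
    \<Rightarrow> (nat \<Rightarrow> 'a) measure" where
  "vol_sampling \<mu> \<phi> m w n = density (PiM {..<n} (\<lambda>_. density \<mu> (\<lambda>x. ennreal (w x))))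
      (\<lambda>x. ennreal (fact (n - m) / fact n * ldet m (gram n (PhiW \<phi> w x))))"

definition concat_tuple :: "nat \<Rightarrow> nat \<Rightarrow> (nat \<Rightarrow> 'a) \<times> (nat \<Rightarrow> 'a) \<Rightarrow> nat \<Rightarrow> 'a" where
  "concat_tuple m n = (\<lambda>(x, y). \<lambda>i\<in>{..<n}. if i < m then x i else y (i - m))"

text \<open>Uniformly random permutation of {..<n} (finite measurable space, so that the
  permutation map is product-measurable).\<close>
definition unif_perm :: "nat \<Rightarrow> (nat \<Rightarrow> nat) measure" where
  "unif_perm n = uniform_count_measure {\<sigma>. \<sigma> permutes {..<n}}"

end

(* The projection determinantal density det(Phi)^2 is, after dividing the rows by sqrt w, also a
   density with respect to nu^m; the support hypothesis makes this an almost sure identity. So the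
   concatenated sample has density det(Phi^w restricted to the first m rows)^2 / m! with respect to
   nu^n. Shuffling averages this over all permutations, and every injection {..<m} -> {..<n} extends
   to (n - m)! permutations, so the Cauchy-Binet formula turns the average into the Gram determinant.
   For the marginals, expand det(Phi)^2 as a double sum over permutations: integrating out all but
   one coordinate, orthonormality kills the off-diagonal terms because two permutations cannot
   differ at a single point. *)

theory Submission
  imports Defs
begin

text \<open>If some basis function were nonzero on a set of positive measure where \<open>w\<close>
  vanishes, gamma_m would charge a set that nu^m does not see, and the density of gamma_n^nu would
  integrate to less than one. This is what \<open>w_supp\<close> excludes.

  Cauchy-Binet is used with a sum over all maps from \<open>{..<m}\<close> to \<open>{..<n}\<close>
  and a factor m!, in place of a sum over m-element subsets. Restrictions of permutations are such
  maps, so this form matches the shuffle directly, and non-injective maps select a repeated row and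
  contribute nothing.

  The Gram determinant of gamma_n^nu is never integrated. Its marginals are read off from the
  shuffled sample: coordinate i is position \<sigma>(i) of the concatenated sample and \<sigma>(i)
  is uniform, so with probability m/n it comes from gamma_m, whose marginals are w_m \<mu>, and
  otherwise from \<nu>. This is the origin of the mixture w-tilde; the final bounds then need only 0
  \<le> w_m \<le> w / \<alpha>.\<close>

subsection \<open>Determinants and the Cauchy-Binet formula\<close>

text \<open>Matrices are total functions, but a permutation of \<open>{..<k}\<close> only reaches
  entries below \<open>k\<close>. This is what allows \<open>restrict\<close> and
  \<open>concat_tuple\<close> to be dropped inside a determinant later.\<close>

lemma ldet_cong:
  assumes "\<And>i j. i < k \<Longrightarrow> j < k \<Longrightarrow> A i j = B i j"
  shows "ldet k A = ldet k B"
  unfolding ldet_def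
proof (intro sum.cong refl arg_cong2[where f = "(*)"] prod.cong)
  fix p i assume "p \<in> {p. p permutes {..<k}}" "i \<in> {..<k}"
  then show "A i (p i) = B i (p i)"
    using assms permutes_in_image[of p "{..<k}" i] by auto
qed

lemma ldet_transpose: "ldet k (\<lambda>i j. A j i) = ldet k A"
proof -
  have "ldet k A = (\<Sum>p | p permutes {..<k}. of_int (sign (inv p)) * (\<Prod>i<k. A i (inv p i)))"
    unfolding ldet_def by (rule sum_permutations_inverse)
  also have "\<dots> = (\<Sum>p | p permutes {..<k}. of_int (sign p) * (\<Prod>i<k. A (p i) i))"
  proof (intro sum.cong refl)
    fix p assume "p \<in> {p. p permutes {..<k}}"
    then have p: "p permutes {..<k}" by simp
    have "(\<Prod>i<k. A i (inv p i)) = (\<Prod>i<k. A (p i) i)"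
      using prod.permute[OF p, of "\<lambda>i. A i (inv p i)"] by (simp add: o_def permutes_inverses[OF p])
    moreover have "sign (inv p) = sign p"
      using permutes_imp_permutation[OF finite_lessThan p] by (rule sign_inverse)
    ultimately show "of_int (sign (inv p)) * (\<Prod>i<k. A i (inv p i))
        = of_int (sign p) * (\<Prod>i<k. A (p i) i)" by simp
  qed
  finally show ?thesis unfolding ldet_def ..
qed

lemma ldet_permute_rows:
  assumes p: "p permutes {..<k}"
  shows "ldet k (\<lambda>i. A (p i)) = of_int (sign p) * ldet k A"
proof -
  have "ldet k (\<lambda>i. A (p i))
      = (\<Sum>q | q permutes {..<k}. of_int (sign (q \<circ> p)) * (\<Prod>i<k. A (p i) ((q \<circ> p) i)))"
    unfolding ldet_def by (rule sum_permutations_compose_right[OF p])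
  also have "\<dots> = (\<Sum>q | q permutes {..<k}. of_int (sign p) * (of_int (sign q) * (\<Prod>i<k. A i (q i))))"
  proof (intro sum.cong refl)
    fix q assume "q \<in> {q. q permutes {..<k}}"
    then have q: "q permutes {..<k}" by simp
    have "(\<Prod>i<k. A (p i) ((q \<circ> p) i)) = (\<Prod>i<k. A i (q i))"
      using prod.permute[OF p, of "\<lambda>i. A i (q i)"] by (simp add: o_def)
    then show "of_int (sign (q \<circ> p)) * (\<Prod>i<k. A (p i) ((q \<circ> p) i))
        = of_int (sign p) * (of_int (sign q) * (\<Prod>i<k. A i (q i)))"
      using sign_compose[OF permutes_imp_permutation[OF finite_lessThan q]
          permutes_imp_permutation[OF finite_lessThan p]]
      by simp
  qed
  finally show ?thesis unfolding ldet_def by (simp add: sum_distrib_left)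
qed

lemma ldet_permute_rows_sq:
  assumes "p permutes {..<k}"
  shows "(ldet k (\<lambda>i. A (p i)))\<^sup>2 = (ldet k A)\<^sup>2"
  by (simp add: ldet_permute_rows[OF assms] power_mult_distrib sign_def)

text \<open>Swapping the rows \<open>a\<close> and \<open>b\<close> fixes the matrix but flips the
  sign, so the determinant is its own negative.\<close>

lemma ldet_equal_rows:
  assumes "a < k" "b < k" "a \<noteq> b" "A a = A b"
  shows "ldet k A = 0"
proof -
  have "(\<lambda>i. A (Transposition.transpose a b i)) = A"
    using assms(4) by (auto simp: fun_eq_iff Transposition.transpose_def)
  then have "ldet k A = of_int (sign (Transposition.transpose a b)) * ldet k A"
    using ldet_permute_rows[OF permutes_swap_id[of a "{..<k}" b], of A] assms by simp
  then show ?thesis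
    using assms(3) by (simp add: sign_swap_id)
qed

lemma ldet_scale_rows: "ldet k (\<lambda>i j. c i * A i j) = (\<Prod>i<k. c i) * ldet k A"
  unfolding ldet_def by (simp add: sum_distrib_left prod.distrib mult_ac)

text \<open>Expanding the product of the sums in \<open>gram\<close> selects a row
  \<open>f i\<close> for each \<open>i\<close>; the sum over permutations then turns one of the two
  products into the determinant of the selected rows (this is \<open>G f\<close>). Averaging over
  reorderings of \<open>f\<close> turns the remaining diagonal product into a second copy of that
  determinant.\<close>

theorem Cauchy_Binet_gram:
  "fact m * ldet m (gram n B) = (\<Sum>f\<in>{..<m} \<rightarrow>\<^sub>E {..<n}. (ldet m (\<lambda>i. B (f i)))\<^sup>2)"
proof -
  let ?F = "{..<m} \<rightarrow>\<^sub>E {..<n}"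
  define G where "G f = (\<Prod>i<m. B (f i) i) * ldet m (\<lambda>i. B (f i))" for f
  have expand: "ldet m (gram n B) = (\<Sum>f\<in>?F. G f)"
  proof -
    have "ldet m (gram n B)
        = (\<Sum>p | p permutes {..<m}. \<Sum>f\<in>?F. of_int (sign p) * (\<Prod>i<m. B (f i) i * B (f i) (p i)))"
      unfolding ldet_def gram_def by (subst prod_sum_PiE) (auto simp: sum_distrib_left)
    also have "\<dots> = (\<Sum>f\<in>?F. G f)"
      by (subst sum.swap) (simp add: G_def ldet_def prod.distrib sum_distrib_left mult_ac)
    finally show ?thesis .
  qed
  \<comment> \<open>Replacing \<open>f\<close> by its composition with \<open>p\<close> only
    reorders the sum. The determinant factor answers with a sign, so \<open>p\<close> survives only
    in that sign and in the diagonal product.\<close>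
  have permute: "(\<Sum>f\<in>?F. G f)
      = (\<Sum>f\<in>?F. of_int (sign p) * (\<Prod>i<m. B (f (p i)) i) * ldet m (\<lambda>i. B (f i)))"
    if p: "p permutes {..<m}" for p
  proof -
    have pl: "p i < m \<longleftrightarrow> i < m" "inv p i < m \<longleftrightarrow> i < m" for i
      using permutes_in_image[OF p, of i] permutes_in_image[OF permutes_inv[OF p], of i] by auto
    show ?thesis
    proof (rule sum.reindex_bij_witness[where i = "\<lambda>f. \<lambda>i\<in>{..<m}. f (p i)"
            and j = "\<lambda>f. \<lambda>i\<in>{..<m}. f (inv p i)"])
      fix f assume f: "f \<in> ?F"
      show "(\<lambda>i\<in>{..<m}. (\<lambda>i\<in>{..<m}. f (inv p i)) (p i)) = f"
        using f by (auto simp: fun_eq_iff pl permutes_inverses[OF p] PiE_def extensional_def)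
      show "(\<lambda>i\<in>{..<m}. (\<lambda>i\<in>{..<m}. f (p i)) (inv p i)) = f"
        using f by (auto simp: fun_eq_iff pl permutes_inverses[OF p] PiE_def extensional_def)
      show "(\<lambda>i\<in>{..<m}. f (p i)) \<in> ?F" "(\<lambda>i\<in>{..<m}. f (inv p i)) \<in> ?F"
        using f by (auto simp: pl PiE_def Pi_def)
      have "ldet m (\<lambda>i. B (f i)) = of_int (sign p) * ldet m (\<lambda>i. B (f (inv p i)))"
        using ldet_permute_rows[OF p, of "\<lambda>i. B (f (inv p i))"] by (simp add: permutes_inverses[OF p])
      moreover have "ldet m (\<lambda>i. B ((\<lambda>i\<in>{..<m}. f (inv p i)) i)) = ldet m (\<lambda>i. B (f (inv p i)))"
        by (rule ldet_cong) auto
      ultimately show "of_int (sign p) * (\<Prod>i<m. B ((\<lambda>i\<in>{..<m}. f (inv p i)) (p i)) i)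
          * ldet m (\<lambda>i. B ((\<lambda>i\<in>{..<m}. f (inv p i)) i)) = G f"
        by (simp add: G_def pl permutes_inverses[OF p])
    qed
  qed
  \<comment> \<open>The factor m! pays for m! copies of the same sum, one for each \<open>p\<close>;
    rewriting the copy of \<open>p\<close> by \<open>permute\<close> makes the sum over
    \<open>p\<close> a Leibniz expansion, of the transposed matrix.\<close>
  have "fact m * ldet m (gram n B) = (\<Sum>p | p permutes {..<m}. \<Sum>f\<in>?F. G f)"
    by (simp add: expand card_permutations[OF card_lessThan])
  also have "\<dots> = (\<Sum>p | p permutes {..<m}.
      \<Sum>f\<in>?F. of_int (sign p) * (\<Prod>i<m. B (f (p i)) i) * ldet m (\<lambda>i. B (f i)))"
    by (intro sum.cong refl permute) simp
  also have "\<dots> = (\<Sum>f\<in>?F. ldet m (\<lambda>i j. B (f j) i) * ldet m (\<lambda>i. B (f i)))"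
    by (subst sum.swap) (simp add: ldet_def[of _ "\<lambda>i j. B (f j) i" for f] sum_distrib_right)
  finally show ?thesis
    by (simp add: ldet_transpose[of _ "\<lambda>i. B (f i)" for f] power2_eq_square)
qed

text \<open>One extension \<tau> exists because \<open>f\<close> leaves out n - m values, as many as
  there are free positions. The extensions are exactly \<open>\<tau> \<circ> \<rho>\<close> with
  \<rho> permuting \<open>{m..<n}\<close>, so they form a coset of size (n - m)!.\<close>

lemma card_permutes_extending:
  assumes f: "inj_on f {..<m}" "f ` {..<m} \<subseteq> {..<n}" and "m \<le> n"
  shows "card {\<sigma>. \<sigma> permutes {..<n} \<and> (\<forall>i<m. \<sigma> i = f i)} = fact (n - m)"
proof -
  have "card ({..<n} - {..<m}) = card ({..<n} - f ` {..<m})"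
    using assms by (simp add: card_Diff_subset card_image)
  then obtain h where h: "bij_betw h ({..<n} - {..<m}) ({..<n} - f ` {..<m})"
    using finite_same_card_bij[of "{..<n} - {..<m}" "{..<n} - f ` {..<m}"] by auto
  define \<tau> where "\<tau> i = (if i < m then f i else if i < n then h i else i)" for i
  have "bij_betw \<tau> ({..<m} \<union> ({..<n} - {..<m})) (f ` {..<m} \<union> ({..<n} - f ` {..<m}))"
  proof (rule bij_betw_combine)
    show "bij_betw \<tau> {..<m} (f ` {..<m})"
      using inj_on_imp_bij_betw[OF f(1)] by (subst bij_betw_cong[of _ _ f]) (auto simp: \<tau>_def)
    show "bij_betw \<tau> ({..<n} - {..<m}) ({..<n} - f ` {..<m})"
      using h by (subst bij_betw_cong[of _ _ h]) (auto simp: \<tau>_def)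
  qed auto
  moreover have "{..<m} \<union> ({..<n} - {..<m}) = {..<n}" "f ` {..<m} \<union> ({..<n} - f ` {..<m}) = {..<n}"
    using assms by auto
  ultimately have \<tau>: "\<tau> permutes {..<n}"
    using \<open>m \<le> n\<close> by (intro bij_imp_permutes) (auto simp: \<tau>_def)
  have "bij_betw (\<lambda>\<rho>. \<tau> \<circ> \<rho>) {\<rho>. \<rho> permutes {m..<n}} {\<sigma>. \<sigma> permutes {..<n} \<and> (\<forall>i<m. \<sigma> i = f i)}"
  proof (rule bij_betwI[where g = "\<lambda>\<sigma>. inv \<tau> \<circ> \<sigma>"])
    show "(\<lambda>\<rho>. \<tau> \<circ> \<rho>) \<in> {\<rho>. \<rho> permutes {m..<n}} \<rightarrow> {\<sigma>. \<sigma> permutes {..<n} \<and> (\<forall>i<m. \<sigma> i = f i)}"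
    proof (intro Pi_I CollectI conjI allI impI)
      fix \<rho> assume "\<rho> \<in> {\<rho>. \<rho> permutes {m..<n}}"
      then have \<rho>: "\<rho> permutes {m..<n}" by simp
      show "\<tau> \<circ> \<rho> permutes {..<n}"
        by (rule permutes_compose[OF permutes_subset[OF \<rho>] \<tau>]) auto
      show "(\<tau> \<circ> \<rho>) i = f i" if "i < m" for i
        using that permutes_not_in[OF \<rho>, of i] by (simp add: \<tau>_def)
    qed
    show "(\<lambda>\<sigma>. inv \<tau> \<circ> \<sigma>) \<in> {\<sigma>. \<sigma> permutes {..<n} \<and> (\<forall>i<m. \<sigma> i = f i)} \<rightarrow> {\<rho>. \<rho> permutes {m..<n}}"
    proof (intro Pi_I CollectI)
      fix \<sigma> assume \<sigma>: "\<sigma> \<in> {\<sigma>. \<sigma> permutes {..<n} \<and> (\<forall>i<m. \<sigma> i = f i)}"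
      show "inv \<tau> \<circ> \<sigma> permutes {m..<n}"
      proof (rule permutes_superset)
        show "inv \<tau> \<circ> \<sigma> permutes {..<n}"
          using \<sigma> permutes_compose[OF _ permutes_inv[OF \<tau>]] by auto
        fix i assume "i \<in> {..<n} - {m..<n}"
        then have "\<sigma> i = \<tau> i" using \<sigma> by (auto simp: \<tau>_def)
        then show "(inv \<tau> \<circ> \<sigma>) i = i" by (simp add: permutes_inverses[OF \<tau>])
      qed
    qed
  qed (auto simp: fun_eq_iff permutes_inverses[OF \<tau>])
  then show ?thesis
    using bij_betw_same_card card_permutations[of "{m..<n}" "n - m"] by fastforce
qed

text \<open>The summand depends only on the restriction of \<sigma> to \<open>{..<m}\<close>, so the
  permutations are grouped by that restriction and the previous count gives the size of each group.
  This evaluates the density of the shuffled sample.\<close>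

lemma sum_permutations_ldet_sq:
  assumes "m \<le> n"
  shows "(\<Sum>\<sigma> | \<sigma> permutes {..<n}. (ldet m (\<lambda>i. B (\<sigma> i)))\<^sup>2)
      = fact (n - m) * (fact m * ldet m (gram n B))"
proof -
  let ?F = "{..<m} \<rightarrow>\<^sub>E {..<n}" and ?P = "{\<sigma>. \<sigma> permutes {..<n}}"
  have fin: "finite ?P" "finite ?F"
    by (auto intro: finite_permutations finite_PiE)
  have im: "(\<lambda>\<sigma>. restrict \<sigma> {..<m}) ` ?P \<subseteq> ?F"
  proof (intro image_subsetI restrict_PiE_iff[THEN iffD2] ballI)
    fix \<sigma> i assume "\<sigma> \<in> ?P" "i \<in> {..<m}"
    then show "\<sigma> i \<in> {..<n}"
      using assms permutes_in_image[of \<sigma> "{..<n}" i] by auto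
  qed
  have "(\<Sum>\<sigma>\<in>?P. (ldet m (\<lambda>i. B (\<sigma> i)))\<^sup>2)
      = (\<Sum>f\<in>?F. \<Sum>\<sigma> | \<sigma> \<in> ?P \<and> restrict \<sigma> {..<m} = f. (ldet m (\<lambda>i. B (\<sigma> i)))\<^sup>2)"
    by (rule sum.group[OF fin im, symmetric])
  also have "\<dots> = (\<Sum>f\<in>?F. fact (n - m) * (ldet m (\<lambda>i. B (f i)))\<^sup>2)"
  proof (intro sum.cong refl)
    fix f assume f: "f \<in> ?F"
    have "(\<Sum>\<sigma> | \<sigma> \<in> ?P \<and> restrict \<sigma> {..<m} = f. (ldet m (\<lambda>i. B (\<sigma> i)))\<^sup>2)
        = (\<Sum>\<sigma> | \<sigma> \<in> ?P \<and> restrict \<sigma> {..<m} = f. (ldet m (\<lambda>i. B (f i)))\<^sup>2)"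
      by (intro sum.cong refl arg_cong[where f = "\<lambda>x. x\<^sup>2"] ldet_cong) auto
    also have "\<dots> = real (card {\<sigma>. \<sigma> \<in> ?P \<and> restrict \<sigma> {..<m} = f}) * (ldet m (\<lambda>i. B (f i)))\<^sup>2"
      by simp
    also have "\<dots> = fact (n - m) * (ldet m (\<lambda>i. B (f i)))\<^sup>2"
    proof (cases "inj_on f {..<m}")
      case True
      have "{\<sigma>. \<sigma> \<in> ?P \<and> restrict \<sigma> {..<m} = f} = {\<sigma>. \<sigma> permutes {..<n} \<and> (\<forall>i<m. \<sigma> i = f i)}"
        using f by (auto simp: fun_eq_iff PiE_def extensional_def)
      then show ?thesis
        using card_permutes_extending[OF True _ assms] f by (simp add: PiE_def image_subset_iff_funcset)
    \<comment> \<open>For a map with a repeated value the group size is irrelevant: two selected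
      rows agree, so both sides vanish.\<close>
    next
      case False
      then obtain a b where "a < m" "b < m" "a \<noteq> b" "f a = f b"
        by (auto simp: inj_on_def)
      then have "ldet m (\<lambda>i. B (f i)) = 0"
        by (intro ldet_equal_rows[of a m b]) auto
      then show ?thesis by simp
    qed
    finally show "(\<Sum>\<sigma> | \<sigma> \<in> ?P \<and> restrict \<sigma> {..<m} = f. (ldet m (\<lambda>i. B (\<sigma> i)))\<^sup>2)
        = fact (n - m) * (ldet m (\<lambda>i. B (f i)))\<^sup>2" .
  qed
  finally show ?thesis
    by (simp add: Cauchy_Binet_gram sum_distrib_left)
qed

text \<open>The case n = m of the sum over permutations: reordering all rows does not change the
  squared determinant, so m! cancels.\<close>

lemma ldet_gram_square: "ldet m (gram m B) = (ldet m B)\<^sup>2"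
proof -
  have "fact m * ldet m (gram m B) = (\<Sum>\<sigma> | \<sigma> permutes {..<m}. (ldet m B)\<^sup>2)"
    using sum_permutations_ldet_sq[of m m B] by (simp add: ldet_permute_rows_sq)
  then show ?thesis
    by (simp add: card_permutations[OF card_lessThan])
qed

text \<open>The value of a uniform permutation at a fixed point is uniform. The sum does not depend
  on the chosen point, by composition with a transposition, and adding it up over all points gives
  every permutation the full sum of \<open>a\<close>.\<close>

lemma sum_permutations_apply:
  fixes a :: "nat \<Rightarrow> 'b::comm_semiring_1"
  assumes "i < n"
  shows "of_nat n * (\<Sum>\<sigma> | \<sigma> permutes {..<n}. a (\<sigma> i)) = of_nat (fact n) * (\<Sum>j<n. a j)"
proof -
  have "(\<Sum>\<sigma> | \<sigma> permutes {..<n}. a (\<sigma> k)) = (\<Sum>\<sigma> | \<sigma> permutes {..<n}. a (\<sigma> i))" if "k < n" for k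
    using sum_permutations_compose_right[OF permutes_swap_id[of i "{..<n}" k], of "\<lambda>\<sigma>. a (\<sigma> k)"] that assms
    by simp
  then have "of_nat n * (\<Sum>\<sigma> | \<sigma> permutes {..<n}. a (\<sigma> i)) = (\<Sum>k<n. \<Sum>\<sigma> | \<sigma> permutes {..<n}. a (\<sigma> k))"
    by simp
  also have "\<dots> = (\<Sum>\<sigma> | \<sigma> permutes {..<n}. \<Sum>k<n. a (\<sigma> k))"
    by (rule sum.swap)
  also have "\<dots> = (\<Sum>\<sigma> | \<sigma> permutes {..<n}. \<Sum>k<n. a k)"
    by (rule sum.cong) (simp_all add: sum.permute[of _ "{..<n}" a] o_def)
  finally show ?thesis
    by (simp add: card_permutations[OF card_lessThan])
qed

subsection \<open>Product measures and random permutations\<close>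

text \<open>It suffices to compare boxes, on which the indicator factorises over the coordinates and
  Tonelli splits the integral. It relates nu^m to mu^m below.\<close>

lemma PiM_density:
  assumes M: "product_sigma_finite M" and D: "product_sigma_finite (\<lambda>i. density (M i) (f i))"
    and [simp]: "finite I" and f: "\<And>i. i \<in> I \<Longrightarrow> f i \<in> borel_measurable (M i)"
  shows "PiM I (\<lambda>i. density (M i) (f i)) = density (PiM I M) (\<lambda>x. \<Prod>i\<in>I. f i (x i))"
proof -
  interpret M: product_sigma_finite M by (rule M)
  interpret D: product_sigma_finite "\<lambda>i. density (M i) (f i)" by (rule D)
  have [measurable]: "(\<lambda>x. f i (x i)) \<in> borel_measurable (PiM I M)" if "i \<in> I" for i
    using measurable_compose[OF measurable_component_singleton[where M = M, OF that] f[OF that]] .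
  show ?thesis
  proof (rule D.PiM_eqI[symmetric])
    show "sets (density (PiM I M) (\<lambda>x. \<Prod>i\<in>I. f i (x i))) = sets (PiM I (\<lambda>i. density (M i) (f i)))"
      by (simp cong: sets_PiM_cong)
    fix A assume "\<And>i. i \<in> I \<Longrightarrow> A i \<in> sets (density (M i) (f i))"
    then have A: "A i \<in> sets (M i)" if "i \<in> I" for i using that by simp
    have "emeasure (density (PiM I M) (\<lambda>x. \<Prod>i\<in>I. f i (x i))) (Pi\<^sub>E I A)
        = (\<integral>\<^sup>+x. (\<Prod>i\<in>I. f i (x i)) * indicator (Pi\<^sub>E I A) x \<partial>PiM I M)"
      using A by (intro emeasure_density) (auto intro!: borel_measurable_prod sets_PiM_I_finite)
    also have "\<dots> = (\<integral>\<^sup>+x. (\<Prod>i\<in>I. f i (x i) * indicator (A i) (x i)) \<partial>PiM I M)"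
    proof (rule nn_integral_cong)
      fix x assume x: "x \<in> space (PiM I M)"
      have "indicator (Pi\<^sub>E I A) x = (\<Prod>i\<in>I. indicator (A i) (x i) :: ennreal)"
      proof (cases "x \<in> Pi\<^sub>E I A")
        case True
        then show ?thesis
          by (simp add: PiE_iff cong: prod.cong)
      next
        case False
        \<comment> \<open>Points of the product space are already extensional, so a point can miss
          the box only through one of its coordinates.\<close>
        with x obtain i where "i \<in> I" "x i \<notin> A i"
          by (auto simp: space_PiM PiE_def)
        then show ?thesis
          using False by (auto simp: prod_zero_iff indicator_def)
      qed
      then show "(\<Prod>i\<in>I. f i (x i)) * indicator (Pi\<^sub>E I A) x = (\<Prod>i\<in>I. f i (x i) * indicator (A i) (x i))"
        by (simp add: prod.distrib)
    qed
    also have "\<dots> = (\<Prod>i\<in>I. \<integral>\<^sup>+x. f i x * indicator (A i) x \<partial>M i)"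
      using f A by (intro M.product_nn_integral_prod) auto
    also have "\<dots> = (\<Prod>i\<in>I. emeasure (density (M i) (f i)) (A i))"
      using f A by (intro prod.cong refl) (simp add: emeasure_density)
    finally show "emeasure (density (PiM I M) (\<lambda>x. \<Prod>i\<in>I. f i (x i))) (Pi\<^sub>E I A)
        = (\<Prod>i\<in>I. emeasure (density (M i) (f i)) (A i))" .
  qed simp
qed

lemma prod_lessThan_add:
  fixes g :: "nat \<Rightarrow> 'b::comm_monoid_mult"
  shows "(\<Prod>i<m + k. g i) = (\<Prod>i<m. g i) * (\<Prod>i<k. g (m + i))"
  by (induction k) (simp_all add: mult.assoc)

lemma measurable_concat_tuple:
  assumes "m \<le> n"
  shows "concat_tuple m n \<in> measurable (PiM {..<m} (\<lambda>_. N) \<Otimes>\<^sub>M PiM {..<n - m} (\<lambda>_. N)) (PiM {..<n} (\<lambda>_. N))"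
  unfolding concat_tuple_def case_prod_unfold
proof (rule measurable_restrict)
  fix i assume "i \<in> {..<n}"
  then show "(\<lambda>p. if i < m then fst p i else snd p (i - m))
      \<in> measurable (PiM {..<m} (\<lambda>_. N) \<Otimes>\<^sub>M PiM {..<n - m} (\<lambda>_. N)) N"
    by (cases "i < m") (auto intro!: measurable_compose[OF measurable_fst measurable_component_singleton]
        measurable_compose[OF measurable_snd measurable_component_singleton])
qed

text \<open>Checked on boxes: the preimage of a box under concatenation is a product of two boxes,
  the second with its indices shifted by \<open>m\<close>.\<close>

lemma distr_concat_tuple_PiM:
  assumes "prob_space N" "m \<le> n"
  shows "distr (PiM {..<m} (\<lambda>_. N) \<Otimes>\<^sub>M PiM {..<n - m} (\<lambda>_. N)) (PiM {..<n} (\<lambda>_. N)) (concat_tuple m n)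
    = PiM {..<n} (\<lambda>_. N)"
proof -
  interpret N: prob_space N by (rule assms)
  interpret product_sigma_finite "\<lambda>_::nat. N" ..
  interpret Q: prob_space "PiM {..<n - m} (\<lambda>_. N)"
    by (rule prob_space_PiM) (rule assms)
  show ?thesis
  proof (rule PiM_eqI)
    fix A :: "nat \<Rightarrow> _" assume A: "\<And>i. i \<in> {..<n} \<Longrightarrow> A i \<in> sets N"
    have "concat_tuple m n -` (Pi\<^sub>E {..<n} A) \<inter> space (PiM {..<m} (\<lambda>_. N) \<Otimes>\<^sub>M PiM {..<n - m} (\<lambda>_. N))
        = Pi\<^sub>E {..<m} A \<times> Pi\<^sub>E {..<n - m} (\<lambda>i. A (m + i))"
    proof (intro set_eqI iffI; clarify)
      fix x y assume *: "(x, y) \<in> space (PiM {..<m} (\<lambda>_. N) \<Otimes>\<^sub>M PiM {..<n - m} (\<lambda>_. N))"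
          "concat_tuple m n (x, y) \<in> Pi\<^sub>E {..<n} A"
      have "x i \<in> A i" if "i < m" for i
        using *(2) that \<open>m \<le> n\<close> by (auto simp: concat_tuple_def PiE_iff dest!: bspec[of _ _ i])
      moreover have "y i \<in> A (m + i)" if "i < n - m" for i
        using *(2) that by (auto simp: concat_tuple_def PiE_iff dest!: bspec[of _ _ "m + i"])
      ultimately show "x \<in> Pi\<^sub>E {..<m} A \<and> y \<in> Pi\<^sub>E {..<n - m} (\<lambda>i. A (m + i))"
        using *(1) by (auto simp: space_pair_measure space_PiM PiE_iff)
    next
      fix x y assume *: "x \<in> Pi\<^sub>E {..<m} A" "y \<in> Pi\<^sub>E {..<n - m} (\<lambda>i. A (m + i))"
      have "x i \<in> space N" if "i < m" for i
        using * that A[of i] \<open>m \<le> n\<close> sets.sets_into_space[of "A i" N] by (auto simp: PiE_iff)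
      moreover have "y i \<in> space N" if "i < n - m" for i
        using * that A[of "m + i"] sets.sets_into_space[of "A (m + i)" N] by (auto simp: PiE_iff)
      moreover have "concat_tuple m n (x, y) i \<in> A i" if "i < n" for i
        using that PiE_mem[OF *(1), of i] PiE_mem[OF *(2), of "i - m"]
        by (cases "i < m") (auto simp: concat_tuple_def)
      ultimately show "(x, y) \<in> concat_tuple m n -` (Pi\<^sub>E {..<n} A)
          \<inter> space (PiM {..<m} (\<lambda>_. N) \<Otimes>\<^sub>M PiM {..<n - m} (\<lambda>_. N))"
        using * by (auto simp: space_pair_measure space_PiM PiE_iff concat_tuple_def)
    qed
    then show "emeasure (distr (PiM {..<m} (\<lambda>_. N) \<Otimes>\<^sub>M PiM {..<n - m} (\<lambda>_. N)) (PiM {..<n} (\<lambda>_. N))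
        (concat_tuple m n)) (Pi\<^sub>E {..<n} A) = (\<Prod>i<n. emeasure N (A i))"
      using A \<open>m \<le> n\<close> prod_lessThan_add[of "\<lambda>i. emeasure N (A i)" m "n - m"]
        emeasure_PiM[of "{..<m}" A] emeasure_PiM[of "{..<n - m}" "\<lambda>i. A (m + i)"]
      by (simp add: emeasure_distr measurable_concat_tuple sets_PiM_I_finite
          Q.emeasure_pair_measure_Times)
  qed simp_all
qed

text \<open>Evaluation at the random index \<open>\<sigma> i\<close> is measurable because \<sigma>
  takes finitely many values and each fixed \<sigma> gives a coordinate projection. Only the
  sigma-algebra of \<open>M\<close> matters, so the law of the sample may be dependent.\<close>

lemma measurable_random_permutation:
  assumes "sets M = sets (PiM {..<n} (\<lambda>_. N))"
  shows "(\<lambda>(x, \<sigma>). \<lambda>i\<in>{..<n}. x (\<sigma> i)) \<in> measurable (M \<Otimes>\<^sub>M unif_perm n) (PiM {..<n} (\<lambda>_. N))"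
proof -
  have "(\<lambda>p. \<lambda>i\<in>{..<n}. fst p (snd p i))
      \<in> measurable (PiM {..<n} (\<lambda>_. N) \<Otimes>\<^sub>M count_space {\<sigma>. \<sigma> permutes {..<n}}) (PiM {..<n} (\<lambda>_. N))"
  proof (rule measurable_restrict, rule measurable_compose_countable'[where I = "{\<sigma>. \<sigma> permutes {..<n}}"
          and f = "\<lambda>\<sigma> p. fst p (\<sigma> i)" and g = snd for i])
    fix i \<sigma> assume "i \<in> {..<n}" "\<sigma> \<in> {\<sigma>. \<sigma> permutes {..<n}}"
    then have "\<sigma> i \<in> {..<n}"
      using permutes_in_image[of \<sigma> "{..<n}" i] by auto
    then show "(\<lambda>p. fst p (\<sigma> i)) \<in> measurable (PiM {..<n} (\<lambda>_. N) \<Otimes>\<^sub>M count_space {\<sigma>. \<sigma> permutes {..<n}}) N"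
      by (intro measurable_compose[OF measurable_fst measurable_component_singleton])
  qed (auto intro: countable_finite finite_permutations)
  also have "measurable (PiM {..<n} (\<lambda>_. N) \<Otimes>\<^sub>M count_space {\<sigma>. \<sigma> permutes {..<n}}) (PiM {..<n} (\<lambda>_. N))
      = measurable (M \<Otimes>\<^sub>M unif_perm n) (PiM {..<n} (\<lambda>_. N))"
    using assms by (intro measurable_cong_sets sets_pair_measure_cong)
      (auto simp: unif_perm_def sets_uniform_count_measure)
  finally show ?thesis by (simp only: case_prod_unfold)
qed

lemma prob_space_unif_perm: "prob_space (unif_perm n)"
  unfolding unif_perm_def
  by (rule prob_space_uniform_count_measure) (auto intro: finite_permutations permutes_id)

text \<open>Tonelli with the permutation as the outer variable; the outer integral is a finite
  average. It serves both the identification of the shuffled density and the computation of the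
  marginals.\<close>

lemma emeasure_random_permutation:
  assumes M: "sets M = sets (PiM {..<n} (\<lambda>_. N))" "sigma_finite_measure M"
    and A: "A \<in> sets (PiM {..<n} (\<lambda>_. N))"
  shows "emeasure (distr (M \<Otimes>\<^sub>M unif_perm n) (PiM {..<n} (\<lambda>_. N)) (\<lambda>(x, \<sigma>). \<lambda>i\<in>{..<n}. x (\<sigma> i))) A
    = ennreal (1 / fact n)
      * (\<Sum>\<sigma> | \<sigma> permutes {..<n}. emeasure M {x \<in> space M. (\<lambda>i\<in>{..<n}. x (\<sigma> i)) \<in> A})"
proof -
  interpret U: prob_space "unif_perm n" by (rule prob_space_unif_perm)
  interpret M: sigma_finite_measure M by (rule M)
  interpret pair_sigma_finite M "unif_perm n" ..
  let ?T = "\<lambda>(x, \<sigma>). \<lambda>i\<in>{..<n}. x (\<sigma> i)"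
  let ?P = "{\<sigma>. \<sigma> permutes {..<n}}"
  have fin: "finite ?P" by (auto intro: finite_permutations)
  have card: "real (card ?P) = fact n"
    using card_permutations[of "{..<n}" n] by simp
  have T: "?T \<in> measurable (M \<Otimes>\<^sub>M unif_perm n) (PiM {..<n} (\<lambda>_. N))"
    by (rule measurable_random_permutation[OF M(1)])
  have sp: "space (unif_perm n) = ?P"
    by (simp add: unif_perm_def space_uniform_count_measure)
  have "emeasure (distr (M \<Otimes>\<^sub>M unif_perm n) (PiM {..<n} (\<lambda>_. N)) ?T) A
      = emeasure (M \<Otimes>\<^sub>M unif_perm n) (?T -` A \<inter> space (M \<Otimes>\<^sub>M unif_perm n))"
    by (rule emeasure_distr[OF T A])
  also have "\<dots> = (\<integral>\<^sup>+\<sigma>. emeasure M ((\<lambda>x. (x, \<sigma>)) -` (?T -` A \<inter> space (M \<Otimes>\<^sub>M unif_perm n))) \<partial>unif_perm n)"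
    by (rule emeasure_pair_measure_alt2[OF measurable_sets[OF T A]])
  also have "\<dots> = (\<integral>\<^sup>+\<sigma>. emeasure M {x \<in> space M. (\<lambda>i\<in>{..<n}. x (\<sigma> i)) \<in> A} \<partial>unif_perm n)"
    by (intro nn_integral_cong arg_cong2[where f = emeasure] refl) (auto simp: space_pair_measure)
  also have "\<dots> = ennreal (1 / fact n) * (\<Sum>\<sigma>\<in>?P. emeasure M {x \<in> space M. (\<lambda>i\<in>{..<n}. x (\<sigma> i)) \<in> A})"
    unfolding unif_perm_def uniform_count_measure_def
    by (simp add: nn_integral_point_measure_finite[OF fin] card sum_distrib_left)
  finally show ?thesis .
qed

text \<open>A product of equal factors is invariant under permuting coordinates, so a change of
  variables moves the permutation from the event into the density, where it appears
  inverted.\<close>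

lemma distr_random_permutation_density:
  assumes N: "prob_space N" and g[measurable]: "g \<in> borel_measurable (PiM {..<n} (\<lambda>_. N))"
    and sf: "sigma_finite_measure (density (PiM {..<n} (\<lambda>_. N)) g)"
  shows "distr (density (PiM {..<n} (\<lambda>_. N)) g \<Otimes>\<^sub>M unif_perm n) (PiM {..<n} (\<lambda>_. N))
      (\<lambda>(x, \<sigma>). \<lambda>i\<in>{..<n}. x (\<sigma> i))
    = density (PiM {..<n} (\<lambda>_. N))
        (\<lambda>x. ennreal (1 / fact n) * (\<Sum>\<sigma> | \<sigma> permutes {..<n}. g (\<lambda>i\<in>{..<n}. x (\<sigma> i))))"
    (is "?L = density ?N ?g")
proof (rule measure_eqI)
  let ?P = "{\<sigma>. \<sigma> permutes {..<n}}"
  let ?T = "\<lambda>\<sigma> x. \<lambda>i\<in>{..<n}. x (\<sigma> i)"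
  have lt: "\<sigma> i < n \<longleftrightarrow> i < n" if "\<sigma> permutes {..<n}" for \<sigma> i
    using permutes_in_image[OF that, of i] by simp
  have T[measurable]: "?T \<sigma> \<in> measurable ?N ?N" if "\<sigma> \<in> ?P" for \<sigma>
    using that by (intro measurable_restrict measurable_component_singleton) (simp add: lt)
  have T_distr: "distr ?N ?N (?T \<sigma>) = ?N" if "\<sigma> \<in> ?P" for \<sigma>
    using that distr_PiM_reindex[of "{..<n}" "\<lambda>_. N" \<sigma> "{..<n}"] N
    by (auto simp: lt intro: permutes_inj_on)
  fix A assume "A \<in> sets ?L"
  then have A[measurable]: "A \<in> sets ?N" by simp
  have "emeasure ?L A = ennreal (1 / fact n)
      * (\<Sum>\<sigma>\<in>?P. emeasure (density ?N g) {x \<in> space (density ?N g). ?T \<sigma> x \<in> A})"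
    by (rule emeasure_random_permutation[OF _ sf A]) simp
  also have "(\<Sum>\<sigma>\<in>?P. emeasure (density ?N g) {x \<in> space (density ?N g). ?T \<sigma> x \<in> A})
      = (\<Sum>\<sigma>\<in>?P. \<integral>\<^sup>+x. g (?T (inv \<sigma>) x) * indicator A x \<partial>?N)"
  proof (rule sum.cong[OF refl])
    fix \<sigma> assume \<sigma>: "\<sigma> \<in> ?P"
    then have \<sigma>': "\<sigma> permutes {..<n}" "inv \<sigma> \<in> ?P" by (auto intro: permutes_inv)
    note T[OF \<sigma>, measurable] T[OF \<sigma>'(2), measurable]
    have "emeasure (density ?N g) {x \<in> space (density ?N g). ?T \<sigma> x \<in> A}
        = (\<integral>\<^sup>+x. g x * indicator {x \<in> space ?N. ?T \<sigma> x \<in> A} x \<partial>?N)"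
      by (simp add: emeasure_density)
    \<comment> \<open>Inserting the inverse makes the whole integrand a function of the permuted
      point, so that the invariance \<open>T_distr\<close> applies.\<close>
    also have "\<dots> = (\<integral>\<^sup>+x. g (?T (inv \<sigma>) (?T \<sigma> x)) * indicator A (?T \<sigma> x) \<partial>?N)"
    proof (rule nn_integral_cong)
      fix x assume x: "x \<in> space ?N"
      then have "?T (inv \<sigma>) (?T \<sigma> x) = x"
        using lt[OF \<sigma>'(1)] lt[OF permutes_inv[OF \<sigma>'(1)]]
        by (auto simp: fun_eq_iff permutes_inverses[OF \<sigma>'(1)] space_PiM PiE_def extensional_def)
      then show "g x * indicator {x \<in> space ?N. ?T \<sigma> x \<in> A} x
          = g (?T (inv \<sigma>) (?T \<sigma> x)) * indicator A (?T \<sigma> x)"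
        using x by (simp add: indicator_def)
    qed
    also have "\<dots> = (\<integral>\<^sup>+x. g (?T (inv \<sigma>) x) * indicator A x \<partial>distr ?N ?N (?T \<sigma>))"
      by (rule nn_integral_distr[symmetric]) measurable
    finally show "emeasure (density ?N g) {x \<in> space (density ?N g). ?T \<sigma> x \<in> A}
        = (\<integral>\<^sup>+x. g (?T (inv \<sigma>) x) * indicator A x \<partial>?N)"
      by (simp add: T_distr[OF \<sigma>])
  qed
  \<comment> \<open>Inversion is a bijection of the permutations, so the inverse disappears after
    averaging.\<close>
  also have "\<dots> = (\<Sum>\<sigma>\<in>?P. \<integral>\<^sup>+x. g (?T \<sigma> x) * indicator A x \<partial>?N)"
    by (rule sum_permutations_inverse[symmetric])
  also have "ennreal (1 / fact n) * \<dots> = (\<integral>\<^sup>+x. ?g x * indicator A x \<partial>?N)"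
    by (simp add: nn_integral_cmult sum_distrib_right mult.assoc flip: nn_integral_sum)
  also have "\<dots> = emeasure (density ?N ?g) A"
    by (rule emeasure_density[symmetric]) measurable
  finally show "emeasure ?L A = emeasure (density ?N ?g) A" .
qed simp

text \<open>The quotient \<open>inv \<tau> \<circ> \<sigma>\<close> fixes every point but
  \<open>j\<close>, hence permutes a singleton and is the identity.\<close>

lemma permutes_eqI_except:
  assumes \<sigma>: "\<sigma> permutes S" and \<tau>: "\<tau> permutes S" and eq: "\<And>i. i \<in> S - {j} \<Longrightarrow> \<sigma> i = \<tau> i"
  shows "\<sigma> = \<tau>"
proof -
  have "inv \<tau> \<circ> \<sigma> permutes {j}"
  proof (rule permutes_superset)
    show "inv \<tau> \<circ> \<sigma> permutes insert j S"
      by (rule permutes_subset[OF permutes_compose[OF \<sigma> permutes_inv[OF \<tau>]]]) auto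
    show "(inv \<tau> \<circ> \<sigma>) i = i" if "i \<in> insert j S - {j}" for i
      using that eq[of i] by (simp add: permutes_inverses[OF \<tau>])
  qed
  then have "inv \<tau> (\<sigma> x) = x" for x by (simp add: fun_eq_iff)
  then show ?thesis
    by (metis ext permutes_inverses(1)[OF \<tau>])
qed

lemma borel_measurable_ldet:
  assumes "\<And>i j. i < k \<Longrightarrow> j < k \<Longrightarrow> (\<lambda>x. A x i j) \<in> borel_measurable M"
  shows "(\<lambda>x. ldet k (A x)) \<in> borel_measurable M"
  unfolding ldet_def
proof (intro borel_measurable_sum borel_measurable_times borel_measurable_const borel_measurable_prod)
  fix p i assume "p \<in> {p. p permutes {..<k}}" "i \<in> {..<k}"
  then show "(\<lambda>x. A x i (p i)) \<in> borel_measurable M"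
    using assms permutes_in_image[of p "{..<k}" i] by auto
qed

subsection \<open>Projection determinantal processes and volume sampling\<close>

lemma wm_nonneg: "0 \<le> wm \<phi> m x"
  unfolding wm_def by (intro mult_nonneg_nonneg sum_nonneg) auto

locale orthonormal_system = prob_space \<mu> for \<mu> :: "'a measure" +
  fixes \<phi> :: "nat \<Rightarrow> 'a \<Rightarrow> real" and m :: nat
  assumes m_pos: "0 < m"
    and phi_meas: "\<And>j. j < m \<Longrightarrow> \<phi> j \<in> borel_measurable \<mu>"
    and phi_L2: "\<And>j. j < m \<Longrightarrow> integrable \<mu> (\<lambda>x. (\<phi> j x)\<^sup>2)"
    and phi_orth: "\<And>i j. i < m \<Longrightarrow> j < m \<Longrightarrow>
      (\<integral>x. \<phi> i x * \<phi> j x \<partial>\<mu>) = (if i = j then 1 else 0)"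
begin

sublocale P: product_prob_space "\<lambda>_::nat. \<mu>" "{..<m}"
  by unfold_locales

lemma integrable_phi_mult:
  assumes "i < m" "j < m"
  shows "integrable \<mu> (\<lambda>x. \<phi> i x * \<phi> j x)"
proof (rule Bochner_Integration.integrable_bound)
  show "integrable \<mu> (\<lambda>x. (\<phi> i x)\<^sup>2 + (\<phi> j x)\<^sup>2)"
    using assms by (intro Bochner_Integration.integrable_add phi_L2)
  show "(\<lambda>x. \<phi> i x * \<phi> j x) \<in> borel_measurable \<mu>"
    using assms phi_meas by (intro borel_measurable_times) auto
  have "\<bar>a * b\<bar> \<le> a\<^sup>2 + b\<^sup>2" for a b :: real
  proof -
    have "2 * (\<bar>a\<bar> * \<bar>b\<bar>) \<le> a\<^sup>2 + b\<^sup>2"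
      using sum_squares_bound[of "\<bar>a\<bar>" "\<bar>b\<bar>"] by simp
    then show ?thesis
      by (simp add: abs_mult) (smt (verit) mult_nonneg_nonneg abs_ge_zero)
  qed
  then show "AE x in \<mu>. norm (\<phi> i x * \<phi> j x) \<le> norm ((\<phi> i x)\<^sup>2 + (\<phi> j x)\<^sup>2)"
    by (simp add: abs_of_nonneg)
qed

text \<open>This one integral provides both the marginals of gamma_m and, with \<open>A\<close> the
  whole space, its normalisation by m!.\<close>

lemma has_integral_det_sq_component:
  assumes j: "j < m" and A: "A \<in> sets \<mu>"
  shows "has_bochner_integral (PiM {..<m} (\<lambda>_. \<mu>))
      (\<lambda>x. (ldet m (Phi \<phi> x))\<^sup>2 * indicator A (x j))
      (\<Sum>\<sigma> | \<sigma> permutes {..<m}. \<integral>x. (\<phi> (\<sigma> j) x)\<^sup>2 * indicator A x \<partial>\<mu>)"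
proof -
  let ?P = "{\<sigma>. \<sigma> permutes {..<m}}"
  \<comment> \<open>The event concerns coordinate \<open>j\<close> alone; placing its indicator in
    the factor \<open>j\<close> keeps every term a product over coordinates.\<close>
  define h where "h i x = (if i = j then indicator A x else 1 :: real)" for i x
  have lt: "\<sigma> i < m" if "\<sigma> \<in> ?P" "i < m" for \<sigma> i
    using that permutes_in_image[of \<sigma> "{..<m}" i] by auto
  have int_h: "integrable \<mu> (\<lambda>x. \<phi> k x * \<phi> l x * h i x)" if "k < m" "l < m" for k l i
    using integrable_real_mult_indicator[OF A integrable_phi_mult[OF that]] integrable_phi_mult[OF that]
    by (cases "i = j") (simp_all add: h_def)
  have expand: "(ldet m (Phi \<phi> x))\<^sup>2 * indicator A (x j)
      = (\<Sum>\<sigma>\<in>?P. \<Sum>\<tau>\<in>?P. of_int (sign \<sigma>) * of_int (sign \<tau>)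
          * (\<Prod>i<m. \<phi> (\<sigma> i) (x i) * \<phi> (\<tau> i) (x i) * h i (x i)))" for x
  proof -
    have "(\<Prod>i<m. h i (x i)) = indicator A (x j)"
      using j by (simp add: h_def prod.delta)
    then show ?thesis
      by (simp add: ldet_def Phi_def power2_eq_square sum_product sum_distrib_left sum_distrib_right
          prod.distrib mult_ac)
  qed
  have term_val: "(\<Prod>i<m. \<integral>x. \<phi> (\<sigma> i) x * \<phi> (\<tau> i) x * h i x \<partial>\<mu>)
      = (if \<sigma> = \<tau> then \<integral>x. (\<phi> (\<sigma> j) x)\<^sup>2 * indicator A x \<partial>\<mu> else 0)"
    if \<sigma>: "\<sigma> \<in> ?P" and \<tau>: "\<tau> \<in> ?P" for \<sigma> \<tau>
  proof (cases "\<sigma> = \<tau>")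
    case True
    have "(\<Prod>i<m. \<integral>x. \<phi> (\<sigma> i) x * \<phi> (\<sigma> i) x * h i x \<partial>\<mu>)
        = (\<Prod>i<m. if i = j then \<integral>x. (\<phi> (\<sigma> j) x)\<^sup>2 * indicator A x \<partial>\<mu> else 1)"
      by (intro prod.cong refl) (auto simp: h_def power2_eq_square phi_orth lt[OF \<sigma>])
    then show ?thesis using True j by (simp add: prod.delta)
  next
    case False
    \<comment> \<open>A disagreement away from \<open>j\<close> is required, since the indicator of
      \<open>A\<close> destroys orthogonality in the factor \<open>j\<close>.\<close>
    then obtain i where "i < m" "i \<noteq> j" "\<sigma> i \<noteq> \<tau> i"
      using permutes_eqI_except[of \<sigma> "{..<m}" \<tau> j] \<sigma> \<tau> by auto
    then have "(\<integral>x. \<phi> (\<sigma> i) x * \<phi> (\<tau> i) x * h i x \<partial>\<mu>) = 0" "i \<in> {..<m}"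
      by (auto simp: h_def phi_orth lt[OF \<sigma>] lt[OF \<tau>])
    then show ?thesis using False by (auto simp: prod_zero_iff)
  qed
  have "has_bochner_integral (PiM {..<m} (\<lambda>_. \<mu>))
      (\<lambda>x. \<Sum>\<sigma>\<in>?P. \<Sum>\<tau>\<in>?P. of_int (sign \<sigma>) * of_int (sign \<tau>)
          * (\<Prod>i<m. \<phi> (\<sigma> i) (x i) * \<phi> (\<tau> i) (x i) * h i (x i)))
      (\<Sum>\<sigma>\<in>?P. \<Sum>\<tau>\<in>?P. of_int (sign \<sigma>) * of_int (sign \<tau>)
          * (\<Prod>i<m. \<integral>x. \<phi> (\<sigma> i) x * \<phi> (\<tau> i) x * h i x \<partial>\<mu>))"
  proof (intro has_bochner_integral_sum has_bochner_integral_mult_right)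
    fix \<sigma> \<tau> assume \<sigma>\<tau>: "\<sigma> \<in> ?P" "\<tau> \<in> ?P"
    show "has_bochner_integral (PiM {..<m} (\<lambda>_. \<mu>))
        (\<lambda>x. \<Prod>i<m. \<phi> (\<sigma> i) (x i) * \<phi> (\<tau> i) (x i) * h i (x i))
        (\<Prod>i<m. \<integral>x. \<phi> (\<sigma> i) x * \<phi> (\<tau> i) x * h i x \<partial>\<mu>)"
      unfolding has_bochner_integral_iff
      using \<sigma>\<tau> P.product_integrable_prod[of "{..<m}" "\<lambda>i x. \<phi> (\<sigma> i) x * \<phi> (\<tau> i) x * h i x"]
        P.product_integral_prod[of "{..<m}" "\<lambda>i x. \<phi> (\<sigma> i) x * \<phi> (\<tau> i) x * h i x"]
      by (auto intro: int_h lt)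
  qed
  also have "(\<Sum>\<sigma>\<in>?P. \<Sum>\<tau>\<in>?P. of_int (sign \<sigma>) * of_int (sign \<tau>)
          * (\<Prod>i<m. \<integral>x. \<phi> (\<sigma> i) x * \<phi> (\<tau> i) x * h i x \<partial>\<mu>))
      = (\<Sum>\<sigma>\<in>?P. \<Sum>\<tau>\<in>?P. if \<sigma> = \<tau> then \<integral>x. (\<phi> (\<sigma> j) x)\<^sup>2 * indicator A x \<partial>\<mu> else 0)"
    by (intro sum.cong refl) (auto simp: term_val sign_def)
  also have "\<dots> = (\<Sum>\<sigma>\<in>?P. \<integral>x. (\<phi> (\<sigma> j) x)\<^sup>2 * indicator A x \<partial>\<mu>)"
    by (intro sum.cong refl) (simp add: sum.delta' finite_permutations)
  finally show ?thesis
    by (simp only: expand)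
qed

lemma measurable_ldet_Phi [measurable]:
  "(\<lambda>x. ldet m (Phi \<phi> x)) \<in> borel_measurable (PiM {..<m} (\<lambda>_. \<mu>))"
  unfolding Phi_def
  by (intro borel_measurable_ldet measurable_compose[OF measurable_component_singleton[where M = "\<lambda>_. \<mu>"]]
      phi_meas) auto

text \<open>Averaging the square of \<open>\<phi> (\<sigma> j)\<close> over all \<sigma> gives each
  basis function weight 1/m, which is exactly \<open>wm\<close>.\<close>

lemma dpp_component:
  assumes j: "j < m" and A: "A \<in> sets \<mu>"
  shows "emeasure (dpp \<mu> \<phi> m) {x \<in> space (dpp \<mu> \<phi> m). x j \<in> A}
    = ennreal (\<integral>x. wm \<phi> m x * indicator A x \<partial>\<mu>)"
proof -
  let ?M = "PiM {..<m} (\<lambda>_. \<mu>)"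
  note A[measurable]
  have [measurable]: "(\<lambda>x. x j) \<in> measurable ?M \<mu>"
    using j by (intro measurable_component_singleton) simp
  note I = has_bochner_integral_divide_zero[OF has_integral_det_sq_component[OF j A], of "fact m"]
  have "real m * (\<Sum>\<sigma> | \<sigma> permutes {..<m}. \<integral>x. (\<phi> (\<sigma> j) x)\<^sup>2 * indicator A x \<partial>\<mu>)
      = fact m * (\<Sum>k<m. \<integral>x. (\<phi> k x)\<^sup>2 * indicator A x \<partial>\<mu>)"
    using sum_permutations_apply[OF j, of "\<lambda>k. \<integral>x. (\<phi> k x)\<^sup>2 * indicator A x \<partial>\<mu>"] by simp
  also have "(\<Sum>k<m. \<integral>x. (\<phi> k x)\<^sup>2 * indicator A x \<partial>\<mu>)
      = (\<integral>x. (\<Sum>k<m. (\<phi> k x)\<^sup>2 * indicator A x) \<partial>\<mu>)"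
    using A phi_L2 by (intro Bochner_Integration.integral_sum[symmetric] integrable_real_mult_indicator) auto
  also have "\<dots> = (\<integral>x. real m * (wm \<phi> m x * indicator A x) \<partial>\<mu>)"
    using m_pos by (intro Bochner_Integration.integral_cong refl)
      (simp add: wm_def sum_distrib_right mult.assoc)
  also have "\<dots> = real m * (\<integral>x. wm \<phi> m x * indicator A x \<partial>\<mu>)"
    by simp
  finally have val: "(\<Sum>\<sigma> | \<sigma> permutes {..<m}. \<integral>x. (\<phi> (\<sigma> j) x)\<^sup>2 * indicator A x \<partial>\<mu>) / fact m
      = (\<integral>x. wm \<phi> m x * indicator A x \<partial>\<mu>)"
    using m_pos by (simp add: field_simps)
  have "emeasure (dpp \<mu> \<phi> m) {x \<in> space (dpp \<mu> \<phi> m). x j \<in> A}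
      = (\<integral>\<^sup>+x. ennreal ((ldet m (Phi \<phi> x))\<^sup>2 / fact m) * indicator {x \<in> space ?M. x j \<in> A} x \<partial>?M)"
    unfolding dpp_def ldet_gram_square by (simp add: emeasure_density)
  also have "\<dots> = (\<integral>\<^sup>+x. ennreal ((ldet m (Phi \<phi> x))\<^sup>2 * indicator A (x j) / fact m) \<partial>?M)"
    by (intro nn_integral_cong) (auto simp: indicator_def)
  also have "\<dots> = ennreal (\<integral>x. (ldet m (Phi \<phi> x))\<^sup>2 * indicator A (x j) / fact m \<partial>?M)"
    using I by (intro nn_integral_eq_integral) (auto simp: has_bochner_integral_iff)
  also have "(\<integral>x. (ldet m (Phi \<phi> x))\<^sup>2 * indicator A (x j) / fact m \<partial>?M)
      = (\<integral>x. wm \<phi> m x * indicator A x \<partial>\<mu>)"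
    using has_bochner_integral_integral_eq[OF I] val by simp
  finally show ?thesis .
qed

lemma integrable_wm: "integrable \<mu> (wm \<phi> m)"
  unfolding wm_def using phi_L2 by (intro integrable_mult_right Bochner_Integration.integrable_sum) auto

lemma integral_wm: "(\<integral>x. wm \<phi> m x \<partial>\<mu>) = 1"
proof -
  have "(\<integral>x. wm \<phi> m x \<partial>\<mu>) = 1 / real m * (\<Sum>k<m. \<integral>x. (\<phi> k x)\<^sup>2 \<partial>\<mu>)"
    unfolding wm_def using phi_L2 by (subst Bochner_Integration.integral_sum[symmetric]) auto
  also have "(\<Sum>k<m. \<integral>x. (\<phi> k x)\<^sup>2 \<partial>\<mu>) = real m"
    using phi_orth[of k k for k] by (simp add: power2_eq_square)
  finally show ?thesis using m_pos by simp
qed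

text \<open>Total mass is the marginal mass of the whole space at coordinate 0, a coordinate that
  exists because m > 0.\<close>

lemma prob_space_dpp: "prob_space (dpp \<mu> \<phi> m)"
proof
  have sp: "space (dpp \<mu> \<phi> m) = space (PiM {..<m} (\<lambda>_. \<mu>))" by (simp add: dpp_def)
  have "space (dpp \<mu> \<phi> m) = {x \<in> space (dpp \<mu> \<phi> m). x 0 \<in> space \<mu>}"
    using m_pos by (auto simp: sp space_PiM)
  then have "emeasure (dpp \<mu> \<phi> m) (space (dpp \<mu> \<phi> m))
      = ennreal (\<integral>x. wm \<phi> m x * indicator (space \<mu>) x \<partial>\<mu>)"
    using dpp_component[OF m_pos sets.top] by simp
  also have "(\<integral>x. wm \<phi> m x * indicator (space \<mu>) x \<partial>\<mu>) = 1"
    using integral_wm by (subst Bochner_Integration.integral_cong[where g = "wm \<phi> m"]) auto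
  finally show "emeasure (dpp \<mu> \<phi> m) (space (dpp \<mu> \<phi> m)) = 1" by simp
qed

end

section \<open>Change of reference measure from \<mu> to \<nu>, and volume sampling as a shuffled
  sample\<close>

locale weighted_orthonormal_system = orthonormal_system \<mu> \<phi> m for \<mu> :: "'a measure" and \<phi> m +
  fixes w :: "'a \<Rightarrow> real"
  assumes w_meas[measurable]: "w \<in> borel_measurable \<mu>"
    and w_nonneg: "\<And>x. x \<in> space \<mu> \<Longrightarrow> 0 \<le> w x"
    and w_int: "integrable \<mu> w"
    and w_dens: "(\<integral>x. w x \<partial>\<mu>) = 1"
    and w_supp: "AE x in \<mu>. w x = 0 \<longrightarrow> (\<forall>j<m. \<phi> j x = 0)"
begin

abbreviation \<nu> :: "'a measure" where "\<nu> \<equiv> density \<mu> (\<lambda>x. ennreal (w x))"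

lemma emeasure_nu: "emeasure \<nu> A = ennreal (\<integral>x. w x * indicator A x \<partial>\<mu>)" if [measurable]: "A \<in> sets \<mu>"
proof -
  have "emeasure \<nu> A = (\<integral>\<^sup>+x. ennreal (w x * indicator A x) \<partial>\<mu>)"
    by (simp add: emeasure_density) (intro nn_integral_cong, auto simp: indicator_def)
  also have "\<dots> = ennreal (\<integral>x. w x * indicator A x \<partial>\<mu>)"
    using w_nonneg by (intro nn_integral_eq_integral integrable_real_mult_indicator w_int AE_I2) auto
  finally show ?thesis .
qed

sublocale nu: prob_space \<nu>
proof
  have "emeasure \<nu> (space \<nu>) = ennreal (\<integral>x. w x * indicator (space \<mu>) x \<partial>\<mu>)"
    using emeasure_nu[OF sets.top] by simp
  also have "(\<integral>x. w x * indicator (space \<mu>) x \<partial>\<mu>) = 1"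
    using w_dens by (subst Bochner_Integration.integral_cong[where g = w]) auto
  finally show "emeasure \<nu> (space \<nu>) = 1" by simp
qed

lemma measurable_ldet_PhiW_reindex:
  assumes "\<And>i. i < m \<Longrightarrow> f i < n"
  shows "(\<lambda>x. ldet m (\<lambda>i. PhiW \<phi> w x (f i))) \<in> borel_measurable (PiM {..<n} (\<lambda>_. \<nu>))"
proof (rule borel_measurable_ldet)
  fix i j assume ij: "i < m" "j < m"
  have "(\<lambda>x. \<phi> j x / sqrt (w x)) \<in> borel_measurable \<nu>"
    using phi_meas[OF ij(2)] by simp
  then show "(\<lambda>x. PhiW \<phi> w x (f i) j) \<in> borel_measurable (PiM {..<n} (\<lambda>_. \<nu>))"
    unfolding PhiW_def using assms[OF ij(1)]
    by (intro measurable_compose[OF measurable_component_singleton[of "f i"]]) auto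
qed

text \<open>Pulling \<open>sqrt (w (x i))\<close> out of each row and squaring produces the product
  of the \<open>w (x i)\<close>, which is the density of nu^m with respect to mu^m.\<close>

lemma dpp_eq_density_weighted:
  "dpp \<mu> \<phi> m = density (PiM {..<m} (\<lambda>_. \<nu>)) (\<lambda>x. ennreal ((ldet m (PhiW \<phi> w x))\<^sup>2 / fact m))"
proof -
  let ?M = "PiM {..<m} (\<lambda>_. \<mu>)"
  have meas_eq: "measurable (PiM {..<m} (\<lambda>_. \<nu>)) borel = measurable ?M borel"
    by (intro measurable_cong_sets sets_PiM_cong) auto
  have D[measurable]: "(\<lambda>x. ldet m (PhiW \<phi> w x)) \<in> borel_measurable ?M"
    using measurable_ldet_PhiW_reindex[of "\<lambda>i. i" m] by (simp add: meas_eq)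
  have [measurable]: "(\<lambda>x. \<Prod>i<m. ennreal (w (x i))) \<in> borel_measurable ?M"
    by (intro borel_measurable_prod_ennreal
        measurable_compose[OF measurable_component_singleton[where M = "\<lambda>_. \<mu>"]]) auto
  have "PiM {..<m} (\<lambda>_. \<nu>) = density ?M (\<lambda>x. \<Prod>i<m. ennreal (w (x i)))"
  proof (rule PiM_density)
    show "product_sigma_finite (\<lambda>_::nat. \<mu>)" "product_sigma_finite (\<lambda>_::nat. \<nu>)"
      by unfold_locales
  qed auto
  then have "density (PiM {..<m} (\<lambda>_. \<nu>)) (\<lambda>x. ennreal ((ldet m (PhiW \<phi> w x))\<^sup>2 / fact m))
      = density ?M (\<lambda>x. (\<Prod>i<m. ennreal (w (x i))) * ennreal ((ldet m (PhiW \<phi> w x))\<^sup>2 / fact m))"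
    by (simp add: density_density_eq)
  also have "\<dots> = density ?M (\<lambda>x. ennreal ((ldet m (Phi \<phi> x))\<^sup>2 / fact m))"
  proof (rule density_cong)
    \<comment> \<open>The exceptional set for one coordinate stays null in the product, and finitely
      many coordinates are combined.\<close>
    have "AE x in ?M. w (x i) = 0 \<longrightarrow> (\<forall>j<m. \<phi> j (x i) = 0)" if "i < m" for i
      using that w_supp prob_space_axioms
      by (intro AE_PiM_component[where M = "\<lambda>_. \<mu>" and P = "\<lambda>y. w y = 0 \<longrightarrow> (\<forall>j<m. \<phi> j y = 0)"]) auto
    then have "AE x in ?M. \<forall>i\<in>{..<m}. w (x i) = 0 \<longrightarrow> (\<forall>j<m. \<phi> j (x i) = 0)"
      by (intro AE_finite_allI) auto
    then show "AE x in ?M. (\<Prod>i<m. ennreal (w (x i))) * ennreal ((ldet m (PhiW \<phi> w x))\<^sup>2 / fact m)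
        = ennreal ((ldet m (Phi \<phi> x))\<^sup>2 / fact m)"
      using AE_space
    proof eventually_elim
      case (elim x)
      then have nonneg: "0 \<le> w (x i)" if "i < m" for i
        using that w_nonneg by (auto simp: space_PiM PiE_iff)
      \<comment> \<open>Where \<open>w\<close> vanishes, \<open>PhiW\<close> is \<open>0\<close> because \<open>x / 0 = 0\<close>, and the row of \<open>Phi\<close> is \<open>0\<close> too.\<close>
      have "ldet m (Phi \<phi> x) = ldet m (\<lambda>i j. sqrt (w (x i)) * PhiW \<phi> w x i j)"
        using elim by (intro ldet_cong) (auto simp: Phi_def PhiW_def)
      also have "\<dots> = (\<Prod>i<m. sqrt (w (x i))) * ldet m (PhiW \<phi> w x)"
        by (rule ldet_scale_rows)
      finally have "(ldet m (Phi \<phi> x))\<^sup>2 = (\<Prod>i<m. w (x i)) * (ldet m (PhiW \<phi> w x))\<^sup>2"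
        using nonneg by (simp add: power_mult_distrib prod_power_distrib cong: prod.cong_simp)
      moreover have "(\<Prod>i<m. ennreal (w (x i))) = ennreal (\<Prod>i<m. w (x i))"
        using nonneg by (intro prod_ennreal) auto
      ultimately show ?case
        using nonneg by (simp add: ennreal_mult''[symmetric])
    qed
  qed simp_all
  finally show ?thesis
    by (simp add: dpp_def ldet_gram_square)
qed

text \<open>The density reads only the first \<open>m\<close> coordinates, which concatenation
  leaves in place, so it can be pulled through the map and only the product measure has to be pushed
  forward.\<close>

lemma concat_dpp_nu:
  assumes "m \<le> n"
  shows "distr (dpp \<mu> \<phi> m \<Otimes>\<^sub>M PiM {..<n - m} (\<lambda>_. \<nu>)) (PiM {..<n} (\<lambda>_. \<mu>)) (concat_tuple m n)
    = density (PiM {..<n} (\<lambda>_. \<nu>)) (\<lambda>x. ennreal ((ldet m (PhiW \<phi> w x))\<^sup>2 / fact m))"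
proof -
  let ?D = "\<lambda>x. ennreal ((ldet m (PhiW \<phi> w x))\<^sup>2 / fact m)"
  let ?P = "PiM {..<m} (\<lambda>_. \<nu>)" and ?Q = "PiM {..<n - m} (\<lambda>_. \<nu>)" and ?N = "PiM {..<n} (\<lambda>_. \<nu>)"
  have D: "?D \<in> borel_measurable (PiM {..<k} (\<lambda>_. \<nu>))" if "m \<le> k" for k
  proof -
    have [measurable]: "(\<lambda>x. ldet m (PhiW \<phi> w x)) \<in> borel_measurable (PiM {..<k} (\<lambda>_. \<nu>))"
      using that by (intro measurable_ldet_PhiW_reindex[of "\<lambda>i. i"]) simp
    then show ?thesis by measurable
  qed
  interpret Q: prob_space ?Q
    by (rule prob_space_PiM) (rule nu.prob_space_axioms)
  \<comment> \<open>The constant density 1 brings the independent factor into the shape required by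
    the product rule for densities.\<close>
  have "dpp \<mu> \<phi> m \<Otimes>\<^sub>M ?Q = density ?P ?D \<Otimes>\<^sub>M density ?Q (\<lambda>_. 1)"
    by (simp add: dpp_eq_density_weighted density_1)
  also have "\<dots> = density (?P \<Otimes>\<^sub>M ?Q) (\<lambda>(x, y). ?D x * 1)"
  proof (rule pair_measure_density)
    show "sigma_finite_measure (density ?Q (\<lambda>_. 1))"
      by (simp add: density_1 Q.sigma_finite_measure_axioms)
  qed (rule D Q.sigma_finite_measure_axioms borel_measurable_const order_refl)+
  also have "\<dots> = density (?P \<Otimes>\<^sub>M ?Q) (\<lambda>p. ?D (concat_tuple m n p))"
  proof -
    have "ldet m (PhiW \<phi> w (concat_tuple m n (x, y))) = ldet m (PhiW \<phi> w x)" for x y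
      using assms by (intro ldet_cong) (auto simp: PhiW_def concat_tuple_def)
    then show ?thesis by (intro arg_cong2[where f = density] refl) auto
  qed
  finally have "distr (dpp \<mu> \<phi> m \<Otimes>\<^sub>M ?Q) ?N (concat_tuple m n)
      = density (distr (?P \<Otimes>\<^sub>M ?Q) ?N (concat_tuple m n)) ?D"
    by (simp add: density_distr[OF D[OF assms] measurable_concat_tuple[OF assms]])
  also have "\<dots> = density ?N ?D"
    by (simp only: distr_concat_tuple_PiM[OF nu.prob_space_axioms assms])
  also have "distr (dpp \<mu> \<phi> m \<Otimes>\<^sub>M ?Q) ?N (concat_tuple m n)
      = distr (dpp \<mu> \<phi> m \<Otimes>\<^sub>M ?Q) (PiM {..<n} (\<lambda>_. \<mu>)) (concat_tuple m n)"
    by (intro distr_cong sets_PiM_cong) auto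
  finally show ?thesis .
qed

lemma prob_space_concat_dpp_nu:
  assumes "m \<le> n"
  shows "prob_space (distr (dpp \<mu> \<phi> m \<Otimes>\<^sub>M PiM {..<n - m} (\<lambda>_. \<nu>)) (PiM {..<n} (\<lambda>_. \<mu>)) (concat_tuple m n))"
proof -
  interpret D: prob_space "dpp \<mu> \<phi> m" by (rule prob_space_dpp)
  interpret Q: prob_space "PiM {..<n - m} (\<lambda>_. \<nu>)"
    by (rule prob_space_PiM) (rule nu.prob_space_axioms)
  interpret DQ: pair_prob_space "dpp \<mu> \<phi> m" "PiM {..<n - m} (\<lambda>_. \<nu>)" ..
  have "measurable (dpp \<mu> \<phi> m \<Otimes>\<^sub>M PiM {..<n - m} (\<lambda>_. \<nu>)) (PiM {..<n} (\<lambda>_. \<mu>))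
      = measurable (PiM {..<m} (\<lambda>_. \<mu>) \<Otimes>\<^sub>M PiM {..<n - m} (\<lambda>_. \<mu>)) (PiM {..<n} (\<lambda>_. \<mu>))"
    by (intro measurable_cong_sets sets_pair_measure_cong sets_PiM_cong refl) (auto simp: dpp_def cong: sets_PiM_cong)
  then show ?thesis
    using measurable_concat_tuple[OF assms, of \<mu>] by (intro DQ.prob_space_distr) simp
qed

theorem random_permutation_concat_eq_vol_sampling:
  assumes "m \<le> n"
  shows "distr (distr (dpp \<mu> \<phi> m \<Otimes>\<^sub>M PiM {..<n - m} (\<lambda>_. \<nu>)) (PiM {..<n} (\<lambda>_. \<mu>)) (concat_tuple m n)
      \<Otimes>\<^sub>M unif_perm n) (PiM {..<n} (\<lambda>_. \<mu>)) (\<lambda>(x, \<sigma>). \<lambda>i\<in>{..<n}. x (\<sigma> i))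
    = vol_sampling \<mu> \<phi> m w n"
proof -
  let ?N = "PiM {..<n} (\<lambda>_. \<nu>)"
  define g where "g x = ennreal ((ldet m (PhiW \<phi> w x))\<^sup>2 / fact m)" for x
  let ?T = "\<lambda>(x, \<sigma>). \<lambda>i\<in>{..<n}. x (\<sigma> i)"
  have [measurable]: "(\<lambda>x. ldet m (PhiW \<phi> w x)) \<in> borel_measurable ?N"
    using assms by (intro measurable_ldet_PhiW_reindex[of "\<lambda>i. i"]) simp
  have g: "g \<in> borel_measurable ?N"
    unfolding g_def by measurable
  \<comment> \<open>The density need not be integrated: it is that of the law of the concatenated
    sample.\<close>
  have "prob_space (density ?N g)"
    using prob_space_concat_dpp_nu[OF assms] unfolding concat_dpp_nu[OF assms] g_def .
  then have sf: "sigma_finite_measure (density ?N g)"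
    by (simp add: prob_space_imp_sigma_finite)
  have "distr (density ?N g \<Otimes>\<^sub>M unif_perm n) (PiM {..<n} (\<lambda>_. \<mu>)) ?T
      = distr (density ?N g \<Otimes>\<^sub>M unif_perm n) ?N ?T"
    by (intro distr_cong sets_PiM_cong) auto
  also have "\<dots> = density ?N (\<lambda>x. ennreal (1 / fact n)
      * (\<Sum>\<sigma> | \<sigma> permutes {..<n}. g (\<lambda>i\<in>{..<n}. x (\<sigma> i))))"
    by (rule distr_random_permutation_density[OF nu.prob_space_axioms g sf])
  also have "\<dots> = vol_sampling \<mu> \<phi> m w n"
    unfolding vol_sampling_def
  proof (intro arg_cong2[where f = density] refl ext)
    fix x
    have "(\<Sum>\<sigma> | \<sigma> permutes {..<n}. g (\<lambda>i\<in>{..<n}. x (\<sigma> i)))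
        = (\<Sum>\<sigma> | \<sigma> permutes {..<n}. ennreal ((ldet m (\<lambda>i. PhiW \<phi> w x (\<sigma> i)))\<^sup>2 / fact m))"
    proof (rule sum.cong[OF refl])
      fix \<sigma>
      have "ldet m (PhiW \<phi> w (\<lambda>i\<in>{..<n}. x (\<sigma> i))) = ldet m (\<lambda>i. PhiW \<phi> w x (\<sigma> i))"
        using assms by (intro ldet_cong) (auto simp: PhiW_def)
      then show "g (\<lambda>i\<in>{..<n}. x (\<sigma> i)) = ennreal ((ldet m (\<lambda>i. PhiW \<phi> w x (\<sigma> i)))\<^sup>2 / fact m)"
        by (simp add: g_def)
    qed
    also have "\<dots> = ennreal ((\<Sum>\<sigma> | \<sigma> permutes {..<n}. (ldet m (\<lambda>i. PhiW \<phi> w x (\<sigma> i)))\<^sup>2) / fact m)"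
      by (simp add: sum_divide_distrib)
    \<comment> \<open>The counting formula contributes (n - m)! m!; here m! cancels the
      normalisation of gamma_m, and the 1/n! of the uniform permutation completes the constant of
      gamma_n^nu.\<close>
    also have "\<dots> = ennreal (fact (n - m) * ldet m (gram n (PhiW \<phi> w x)))"
      by (simp add: sum_permutations_ldet_sq[OF assms])
    finally show "ennreal (1 / fact n) * (\<Sum>\<sigma> | \<sigma> permutes {..<n}. g (\<lambda>i\<in>{..<n}. x (\<sigma> i)))
        = ennreal (fact (n - m) / fact n * ldet m (gram n (PhiW \<phi> w x)))"
      by (simp add: ennreal_mult'[symmetric])
  qed
  finally show ?thesis
    unfolding concat_dpp_nu[OF assms] g_def .
qed

text \<open>Before the shuffle the event at position \<open>j\<close> is a rectangle with one full
  side, so only the block containing \<open>j\<close> contributes.\<close>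

lemma concat_dpp_nu_component:
  assumes "m \<le> n" "j < n" and A[measurable]: "A \<in> sets \<mu>"
  shows "emeasure (distr (dpp \<mu> \<phi> m \<Otimes>\<^sub>M PiM {..<n - m} (\<lambda>_. \<nu>)) (PiM {..<n} (\<lambda>_. \<mu>)) (concat_tuple m n))
      {x \<in> space (PiM {..<n} (\<lambda>_. \<mu>)). x j \<in> A}
    = ennreal (\<integral>x. (if j < m then wm \<phi> m x else w x) * indicator A x \<partial>\<mu>)"
proof -
  let ?D = "dpp \<mu> \<phi> m" and ?Q = "PiM {..<n - m} (\<lambda>_. \<nu>)" and ?N = "PiM {..<n} (\<lambda>_. \<mu>)"
  interpret D: prob_space ?D by (rule prob_space_dpp)
  interpret Q: prob_space ?Q
    by (rule prob_space_PiM) (rule nu.prob_space_axioms)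
  have "sets ?D = sets (PiM {..<m} (\<lambda>_. \<mu>))" by (simp add: dpp_def)
  then have spD: "space ?D = space (PiM {..<m} (\<lambda>_. \<mu>))" by (rule sets_eq_imp_space_eq)
  have "measurable (?D \<Otimes>\<^sub>M ?Q) ?N
      = measurable (PiM {..<m} (\<lambda>_. \<mu>) \<Otimes>\<^sub>M PiM {..<n - m} (\<lambda>_. \<mu>)) ?N"
    by (intro measurable_cong_sets sets_pair_measure_cong sets_PiM_cong refl) (auto simp: dpp_def cong: sets_PiM_cong)
  then have cm: "concat_tuple m n \<in> measurable (?D \<Otimes>\<^sub>M ?Q) ?N"
    using measurable_concat_tuple[OF assms(1), of \<mu>] by simp
  have j: "j \<in> {..<n}" using assms(2) by simp
  have "{x \<in> space ?N. x j \<in> A} \<in> sets ?N"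
    using j by measurable
  then have "emeasure (distr (?D \<Otimes>\<^sub>M ?Q) ?N (concat_tuple m n)) {x \<in> space ?N. x j \<in> A}
      = emeasure (?D \<Otimes>\<^sub>M ?Q) (concat_tuple m n -` {x \<in> space ?N. x j \<in> A} \<inter> space (?D \<Otimes>\<^sub>M ?Q))"
    by (rule emeasure_distr[OF cm])
  also have "concat_tuple m n -` {x \<in> space ?N. x j \<in> A} \<inter> space (?D \<Otimes>\<^sub>M ?Q)
      = {p \<in> space (?D \<Otimes>\<^sub>M ?Q). concat_tuple m n p j \<in> A}"
    using measurable_space[OF cm] by auto
  also have "emeasure (?D \<Otimes>\<^sub>M ?Q) \<dots>
      = ennreal (\<integral>x. (if j < m then wm \<phi> m x else w x) * indicator A x \<partial>\<mu>)"
  proof (cases "j < m")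
    case True
    then have "j \<in> {..<m}" by simp
    then have "{x \<in> space (PiM {..<m} (\<lambda>_. \<mu>)). x j \<in> A} \<in> sets (PiM {..<m} (\<lambda>_. \<mu>))"
      by measurable
    then have s: "{x \<in> space ?D. x j \<in> A} \<in> sets ?D"
      by (simp add: dpp_def)
    have "{p \<in> space (?D \<Otimes>\<^sub>M ?Q). concat_tuple m n p j \<in> A} = {x \<in> space ?D. x j \<in> A} \<times> space ?Q"
      using True assms by (auto simp: space_pair_measure concat_tuple_def)
    then have "emeasure (?D \<Otimes>\<^sub>M ?Q) {p \<in> space (?D \<Otimes>\<^sub>M ?Q). concat_tuple m n p j \<in> A}
        = emeasure ?D {x \<in> space ?D. x j \<in> A}"
      using Q.emeasure_pair_measure_Times[OF s sets.top] by (simp add: Q.emeasure_space_1)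
    then show ?thesis
      using True by (simp add: dpp_component)
  next
    case False
    then have k: "j - m \<in> {..<n - m}" using assms by auto
    have cs: "(\<lambda>y. y (j - m)) \<in> measurable ?Q \<nu>"
      by (rule measurable_component_singleton[OF k])
    have s: "(\<lambda>y. y (j - m)) -` A \<inter> space ?Q \<in> sets ?Q"
      by (rule measurable_sets[OF cs]) simp
    have "{p \<in> space (?D \<Otimes>\<^sub>M ?Q). concat_tuple m n p j \<in> A}
        = space ?D \<times> ((\<lambda>y. y (j - m)) -` A \<inter> space ?Q)"
      using False assms by (auto simp: space_pair_measure concat_tuple_def)
    then have "emeasure (?D \<Otimes>\<^sub>M ?Q) {p \<in> space (?D \<Otimes>\<^sub>M ?Q). concat_tuple m n p j \<in> A}
        = emeasure ?Q ((\<lambda>y. y (j - m)) -` A \<inter> space ?Q)"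
      using Q.emeasure_pair_measure_Times[OF sets.top[of ?D] s] by (simp add: D.emeasure_space_1)
    also have "\<dots> = emeasure (distr ?Q \<nu> (\<lambda>y. y (j - m))) A"
      by (rule emeasure_distr[OF cs, symmetric]) simp
    also have "distr ?Q \<nu> (\<lambda>y. y (j - m)) = \<nu>"
      using distr_PiM_component[OF _ k, of "\<lambda>_. \<nu>"] nu.prob_space_axioms by simp
    finally show ?thesis
      using False by (simp add: emeasure_nu)
  qed
  finally show ?thesis .
qed

section \<open>Marginals of volume sampling, computed through the random permutation\<close>

theorem vol_sampling_marginal:
  assumes "m \<le> n" "i < n"
  shows "distr (vol_sampling \<mu> \<phi> m w n) \<mu> (\<lambda>x. x i)
    = density \<mu> (\<lambda>x. ennreal (real m / real n * wm \<phi> m x + real (n - m) / real n * w x))"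
    (is "?L = density \<mu> (\<lambda>x. ennreal (?f x))")
proof (rule measure_eqI)
  let ?N = "PiM {..<n} (\<lambda>_. \<mu>)"
  let ?C = "distr (dpp \<mu> \<phi> m \<Otimes>\<^sub>M PiM {..<n - m} (\<lambda>_. \<nu>)) ?N (concat_tuple m n)"
  let ?P = "{\<sigma>. \<sigma> permutes {..<n}}"
  fix A assume "A \<in> sets ?L"
  then have A[measurable]: "A \<in> sets \<mu>" by simp
  define I :: "('a \<Rightarrow> real) \<Rightarrow> real" where "I f = (\<integral>x. f x * indicator A x \<partial>\<mu>)" for f
  have I_nonneg: "0 \<le> I w" "0 \<le> I (wm \<phi> m)"
    unfolding I_def using w_nonneg wm_nonneg
    by (auto intro!: integral_nonneg_AE AE_I2 mult_nonneg_nonneg)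
  note borel_measurable_integrable[OF integrable_wm, measurable]
  interpret C: prob_space ?C by (rule prob_space_concat_dpp_nu[OF assms(1)])
  have i[measurable]: "(\<lambda>x. x i) \<in> measurable ?N \<mu>"
    using assms by (intro measurable_component_singleton) simp
  have sets_vol: "sets (vol_sampling \<mu> \<phi> m w n) = sets ?N"
    by (auto simp: vol_sampling_def cong: sets_PiM_cong)
  have "emeasure ?L A = emeasure (vol_sampling \<mu> \<phi> m w n) ((\<lambda>x. x i) -` A \<inter> space (vol_sampling \<mu> \<phi> m w n))"
    using i by (intro emeasure_distr A) (simp add: measurable_cong_sets[OF sets_vol refl])
  also have "(\<lambda>x. x i) -` A \<inter> space (vol_sampling \<mu> \<phi> m w n) = {x \<in> space ?N. x i \<in> A}"
    using sets_eq_imp_space_eq[OF sets_vol] by auto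
  also have "emeasure (vol_sampling \<mu> \<phi> m w n) \<dots> = ennreal (1 / fact n)
      * (\<Sum>\<sigma>\<in>?P. emeasure ?C {x \<in> space ?C. (\<lambda>k\<in>{..<n}. x (\<sigma> k)) \<in> {x \<in> space ?N. x i \<in> A}})"
    unfolding random_permutation_concat_eq_vol_sampling[OF assms(1), symmetric]
    by (rule emeasure_random_permutation) (auto intro: C.sigma_finite_measure_axioms)
  also have "(\<Sum>\<sigma>\<in>?P. emeasure ?C {x \<in> space ?C. (\<lambda>k\<in>{..<n}. x (\<sigma> k)) \<in> {x \<in> space ?N. x i \<in> A}})
      = (\<Sum>\<sigma>\<in>?P. ennreal (if \<sigma> i < m then I (wm \<phi> m) else I w))"
  proof (rule sum.cong[OF refl])
    fix \<sigma> assume "\<sigma> \<in> ?P"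
    then have lt: "\<sigma> k < n \<longleftrightarrow> k < n" for k
      using permutes_in_image[of \<sigma> "{..<n}" k] by auto
    have "{x \<in> space ?C. (\<lambda>k\<in>{..<n}. x (\<sigma> k)) \<in> {x \<in> space ?N. x i \<in> A}} = {x \<in> space ?N. x (\<sigma> i) \<in> A}"
      using assms(2) lt by (auto simp: space_PiM PiE_iff)
    then show "emeasure ?C {x \<in> space ?C. (\<lambda>k\<in>{..<n}. x (\<sigma> k)) \<in> {x \<in> space ?N. x i \<in> A}}
        = ennreal (if \<sigma> i < m then I (wm \<phi> m) else I w)"
      using concat_dpp_nu_component[OF assms(1) _ A, of "\<sigma> i"] assms(2) lt by (simp add: I_def)
  qed
  also have "ennreal (1 / fact n) * \<dots>
      = ennreal (1 / fact n * (\<Sum>\<sigma>\<in>?P. if \<sigma> i < m then I (wm \<phi> m) else I w))"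
    using I_nonneg by (subst sum_ennreal) (auto simp: ennreal_mult'[symmetric])
  \<comment> \<open>Uniformity of \<open>\<sigma> i\<close> turns the average over permutations into
    an average over positions, of which \<open>m\<close> belong to gamma_m and n - m to
    \<nu>.\<close>
  also have "1 / fact n * (\<Sum>\<sigma>\<in>?P. if \<sigma> i < m then I (wm \<phi> m) else I w)
      = real m / real n * I (wm \<phi> m) + real (n - m) / real n * I w"
  proof -
    have "real n * (\<Sum>\<sigma>\<in>?P. if \<sigma> i < m then I (wm \<phi> m) else I w)
        = fact n * (\<Sum>j<n. if j < m then I (wm \<phi> m) else I w)"
      using sum_permutations_apply[OF assms(2), of "\<lambda>j. if j < m then I (wm \<phi> m) else I w"] by simp
    also have "(\<Sum>j<n. if j < m then I (wm \<phi> m) else I w) = real m * I (wm \<phi> m) + real (n - m) * I w"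
    proof -
      have "{..<n} \<inter> {j. j < m} = {..<m}" "{..<n} \<inter> - {j. j < m} = {m..<n}"
        using assms(1) by auto
      then show ?thesis by (simp add: sum.If_cases)
    qed
    finally show ?thesis
      using assms(2) by (simp add: field_simps)
  qed
  also have "real m / real n * I (wm \<phi> m) + real (n - m) / real n * I w = (\<integral>x. ?f x * indicator A x \<partial>\<mu>)"
    unfolding I_def using integrable_real_mult_indicator[OF A integrable_wm]
      integrable_real_mult_indicator[OF A w_int]
    by (simp add: distrib_right mult.assoc)
  also have "ennreal \<dots> = (\<integral>\<^sup>+x. ennreal (?f x * indicator A x) \<partial>\<mu>)"
    using w_nonneg wm_nonneg
    by (intro nn_integral_eq_integral[symmetric] integrable_real_mult_indicator A
        Bochner_Integration.integrable_add integrable_mult_right integrable_wm w_int AE_I2)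
      (auto intro!: mult_nonneg_nonneg add_nonneg_nonneg divide_nonneg_nonneg)
  also have "\<dots> = (\<integral>\<^sup>+x. ennreal (?f x) * indicator A x \<partial>\<mu>)"
    by (intro nn_integral_cong) (auto simp: indicator_def)
  also have "\<dots> = emeasure (density \<mu> (\<lambda>x. ennreal (?f x))) A"
    by (rule emeasure_density[symmetric]) measurable
  finally show "emeasure ?L A = emeasure (density \<mu> (\<lambda>x. ennreal (?f x))) A" .
qed simp

end

theorem mainTheorem7:
  fixes \<mu> :: "'a::polish_space measure"
    and \<phi> :: "nat \<Rightarrow> 'a \<Rightarrow> real"
    and w :: "'a \<Rightarrow> real"
    and m n :: nat
  assumes mu_borel: "sets \<mu> = sets borel"
    and mu_prob: "prob_space \<mu>"
    and m_pos: "1 \<le> m"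
    and phi_meas: "\<And>j. j < m \<Longrightarrow> \<phi> j \<in> borel_measurable \<mu>"
    and phi_L2: "\<And>j. j < m \<Longrightarrow> integrable \<mu> (\<lambda>x. (\<phi> j x)\<^sup>2)"
    and phi_orth: "\<And>i j. i < m \<Longrightarrow> j < m \<Longrightarrow>
                     (\<integral>x. \<phi> i x * \<phi> j x \<partial>\<mu>) = (if i = j then 1 else 0)"
    and w_meas: "w \<in> borel_measurable \<mu>"
    and w_nonneg: "\<And>x. x \<in> space \<mu> \<Longrightarrow> 0 \<le> w x"
    and w_int: "integrable \<mu> w"
    and w_dens: "(\<integral>x. w x \<partial>\<mu>) = 1"
    and w_supp: "AE x in \<mu>. w x = 0 \<longrightarrow> (\<forall>j<m. \<phi> j x = 0)"
    and nm: "m \<le> n"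
  shows
    "distr ((distr (dpp \<mu> \<phi> m \<Otimes>\<^sub>M PiM {..<n - m} (\<lambda>_. density \<mu> (\<lambda>x. ennreal (w x))))
                   (PiM {..<n} (\<lambda>_. \<mu>)) (concat_tuple m n))
            \<Otimes>\<^sub>M unif_perm n)
        (PiM {..<n} (\<lambda>_. \<mu>)) (\<lambda>(x, \<sigma>). \<lambda>i\<in>{..<n}. x (\<sigma> i))
       = vol_sampling \<mu> \<phi> m w n
   \<and> (\<forall>i<n. distr (vol_sampling \<mu> \<phi> m w n) \<mu> (\<lambda>x. x i)
            = density \<mu> (\<lambda>x. ennreal (real m / real n * wm \<phi> m x + real (n - m) / real n * w x)))
   \<and> (\<forall>\<alpha>>0. (\<forall>x\<in>space \<mu>. \<alpha> * wm \<phi> m x \<le> w x) \<longrightarrow>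
        (\<forall>x\<in>space \<mu>.
           (1 - real m / real n) * w x \<le> real m / real n * wm \<phi> m x + real (n - m) / real n * w x
         \<and> real m / real n * wm \<phi> m x + real (n - m) / real n * w x
             \<le> (1 + (1 / \<alpha> - 1) * (real m / real n)) * w x))"
proof -
  interpret prob_space \<mu> by (rule mu_prob)
  interpret weighted_orthonormal_system \<mu> \<phi> m w
    using assms by unfold_locales auto
  \<comment> \<open>A pointwise inequality with \<open>u\<close> for \<open>wm \<phi> m x\<close>
    and \<open>v\<close> for \<open>w x\<close>: the lower bound drops the nonnegative term in
    \<open>u\<close>, the upper one replaces \<open>u\<close> by
    \<open>v / \<alpha>\<close>.\<close>
  have bounds: "(1 - real m / real n) * v \<le> real m / real n * u + real (n - m) / real n * v
      \<and> real m / real n * u + real (n - m) / real n * v \<le> (1 + (1 / \<alpha> - 1) * (real m / real n)) * v"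
    if "0 < \<alpha>" "\<alpha> * u \<le> v" "0 \<le> u" for \<alpha> u v :: real
  proof -
    define a where "a = real m / real n"
    \<comment> \<open>Natural subtraction is exact because m \<le> n, and n > 0 follows from 1 \<le>
      m.\<close>
    have "real (n - m) / real n = 1 - a"
      using m_pos nm by (simp add: a_def of_nat_diff field_simps)
    moreover have "a * u \<le> a * (v / \<alpha>)"
      using that by (intro mult_left_mono) (auto simp: a_def field_simps)
    moreover have "0 \<le> a * u"
      using that by (simp add: a_def)
    moreover have "(1 + (1 / \<alpha> - 1) * a) * v = (1 - a) * v + a * (v / \<alpha>)"
      by (simp add: algebra_simps)
    ultimately show ?thesis
      by (simp flip: a_def)
  qed
  show ?thesis
    using random_permutation_concat_eq_vol_sampling[OF nm] vol_sampling_marginal[OF nm]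
    by (intro conjI allI impI ballI)
      (blast intro: bounds[THEN conjunct1] bounds[THEN conjunct2] wm_nonneg)+
qed

end
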